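(* For a finite, positive, nonzero Borel measure $\mu$ on $\mathbb{R}$ put $$Q(\mu):=\inf_{1>a>b>0}\frac{(\mu\star\mu)([b,a])}{(a-b)\,\|\mu\|_{TV}^2},$$ and let $\mathfrak{C}_4:=\sup_{\mu}Q(\mu)$, the supremum being over all finite, positive, nonzero measures $\mu$ on $\mathbb{R}$. Let $y_0$ be the smallest positive number with $y_0=\tan(y_0)$ and let $\theta_0:=-\frac{\sin(y_0)}{y_0}$. Then at least one of the following holds: 1. there is no finite, positive measure $\mu_0$ on $\mathbb{R}$ that maximizes $Q$ over the class of all finite, positive, nonzero measures on $\mathbb{R}$; 2. $\mathfrak{C}_4$ is strictly less than $\frac{1}{2(1+\theta_0)}$. Moreover, item 1 can happen only if no extremizing sequence $\{\mu_n\}_{n\ge 0}$ is tight.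
   Context: For a finite positive measure $\mu$ on $\mathbb{R}$, its autocorrelation is the measure $(\mu\star\mu)(A)=\int_{\mathbb{R}\times\mathbb{R}}1_A(x-y)\,d\mu(x)\,d\mu(y)$, and $\|\mu\|_{TV}=|\mu|(\mathbb{R})$ is its total variation. An extremizing sequence is a sequence of finite positive measures $\mu_n$, normalized by $\|\mu_n\|_{TV}=1$ (note that $Q$ is invariant under multiplying $\mu$ by a positive constant), with $Q(\mu_n)\to\mathfrak{C}_4$. It is tight if for every $\varepsilon>0$ there is a compact $K\subset\mathbb{R}$ with $\mu_n(\mathbb{R}\setminus K)<\varepsilon$ for all $n$. *)

theory Defs
  imports "HOL-Probability.Probability"
begin

definition admissible :: "real measure \<Rightarrow> bool" where
  "admissible \<mu> \<longleftrightarrow> finite_measure \<mu> \<and> sets \<mu> = sets borel \<and> emeasure \<mu> UNIV \<noteq> 0"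

text \<open>The push-forward of the product measure under \<open>(x, y) \<mapsto> x - y\<close>; see
  \<open>emeasure_autocorrelation\<close> for the integral formula.\<close>

definition autocorrelation :: "real measure \<Rightarrow> real measure" where
  "autocorrelation \<mu> = distr (\<mu> \<Otimes>\<^sub>M \<mu>) borel (\<lambda>(x, y). x - y)"

text \<open>The total variation measure of a positive measure is the measure itself.\<close>

definition tv_norm :: "real measure \<Rightarrow> real" where
  "tv_norm \<mu> = measure \<mu> UNIV"

definition Q :: "real measure \<Rightarrow> real" where
  "Q \<mu> = (INF (a, b) \<in> {(a, b). 1 > a \<and> a > b \<and> b > 0}.
            measure (autocorrelation \<mu>) {b..a} / ((a - b) * (tv_norm \<mu>)\<^sup>2))"

text \<open>The infimum and the supremum are taken in the reals; the lemmas \<open>bdd_below_Q\<close> and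
  \<open>bdd_above_Q\<close> show that the sets involved are bounded.\<close>

definition C4 :: real where
  "C4 = (SUP \<mu> \<in> {\<mu>. admissible \<mu>}. Q \<mu>)"

text \<open>Since \<open>x / 0 = 0\<close>, the library's tangent vanishes at its poles, so these
  contribute no positive solutions of \<open>y = tan y\<close>.\<close>

definition y0 :: real where
  "y0 = (LEAST y. y > 0 \<and> y = tan y)"

definition \<theta>0 :: real where
  "\<theta>0 = - (sin y0 / y0)"

definition maximizer :: "real measure \<Rightarrow> bool" where
  "maximizer \<mu>0 \<longleftrightarrow> admissible \<mu>0 \<and> (\<forall>\<mu>. admissible \<mu> \<longrightarrow> Q \<mu> \<le> Q \<mu>0)"

definition extremizing_seq :: "(nat \<Rightarrow> real measure) \<Rightarrow> bool" where
  "extremizing_seq \<mu> \<longleftrightarrow>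
     (\<forall>n. admissible (\<mu> n) \<and> tv_norm (\<mu> n) = 1) \<and> (\<lambda>n. Q (\<mu> n)) \<longlonglongrightarrow> C4"

text \<open>The library's \<open>tight\<close> uses half-open intervals in place of compact sets and
  includes the requirement that the measures be probability measures.\<close>

definition tight_seq :: "(nat \<Rightarrow> real measure) \<Rightarrow> bool" where
  "tight_seq \<mu> \<longleftrightarrow> (\<forall>\<epsilon>>0. \<exists>K. compact K \<and> (\<forall>n. measure (\<mu> n) (UNIV - K) < \<epsilon>))"

lemma emeasure_autocorrelation:
  assumes "admissible \<mu>" and A: "A \<in> sets borel"
  shows "emeasure (autocorrelation \<mu>) A
           = (\<integral>\<^sup>+x. \<integral>\<^sup>+y. indicator A (x - y) \<partial>\<mu> \<partial>\<mu>)"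
proof -
  interpret finite_measure \<mu> using assms(1) by (simp add: admissible_def)
  have s[measurable_cong]: "sets \<mu> = sets borel" using assms(1) by (simp add: admissible_def)
  have f[measurable]: "(\<lambda>(x, y). x - y) \<in> measurable (\<mu> \<Otimes>\<^sub>M \<mu>) borel" by measurable
  note A[measurable]
  have "emeasure (autocorrelation \<mu>) A = (\<integral>\<^sup>+z. indicator A z \<partial>autocorrelation \<mu>)"
    using A by (simp add: autocorrelation_def)
  also have "\<dots> = (\<integral>\<^sup>+z. indicator A (case z of (x, y) \<Rightarrow> x - y) \<partial>(\<mu> \<Otimes>\<^sub>M \<mu>))"
    unfolding autocorrelation_def by (rule nn_integral_distr) (use A in auto)
  also have "\<dots> = (\<integral>\<^sup>+x. \<integral>\<^sup>+y. indicator A (x - y) \<partial>\<mu> \<partial>\<mu>)"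
    by (subst nn_integral_fst[symmetric]) auto
  finally show ?thesis .
qed

lemma bdd_below_Q:
  "bdd_below ((\<lambda>(a, b). measure (autocorrelation \<mu>) {b..a} / ((a - b) * (tv_norm \<mu>)\<^sup>2))
     ` {(a, b). 1 > a \<and> a > b \<and> b > 0})"
  by (rule bdd_belowI[of _ 0]) auto

lemma measure_autocorrelation_le:
  assumes "admissible \<mu>"
  shows "measure (autocorrelation \<mu>) A \<le> (tv_norm \<mu>)\<^sup>2"
proof -
  interpret finite_measure \<mu> using assms by (simp add: admissible_def)
  have s[measurable_cong]: "sets \<mu> = sets borel" using assms by (simp add: admissible_def)
  have sp: "space \<mu> = UNIV" using sets_eq_imp_space_eq[OF s] by simp
  interpret P: pair_sigma_finite \<mu> \<mu> ..
  interpret F: finite_measure "\<mu> \<Otimes>\<^sub>M \<mu>" by (intro finite_measure_pair_measure) unfold_locales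
  have f[measurable]: "(\<lambda>(x, y). x - y) \<in> measurable (\<mu> \<Otimes>\<^sub>M \<mu>) borel" by measurable
  interpret D: finite_measure "autocorrelation \<mu>"
    unfolding autocorrelation_def by (rule F.finite_measure_distr[OF f])
  have "measure (autocorrelation \<mu>) A \<le> measure (autocorrelation \<mu>) UNIV"
    using D.bounded_measure[of A] by (simp add: autocorrelation_def)
  also have "\<dots> = measure (\<mu> \<Otimes>\<^sub>M \<mu>) (UNIV \<times> UNIV)"
    unfolding autocorrelation_def by (subst measure_distr[OF f]) (auto simp: space_pair_measure sp)
  also have "\<dots> = (tv_norm \<mu>)\<^sup>2"
    using emeasure_pair_measure_Times[of UNIV \<mu> UNIV] s
    by (simp add: measure_def tv_norm_def enn2real_mult power2_eq_square del: UNIV_Times_UNIV)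
  finally show ?thesis .
qed

lemma bdd_above_Q: "bdd_above (Q ` {\<mu>. admissible \<mu>})"
proof (rule bdd_aboveI2)
  fix \<mu> assume "\<mu> \<in> {\<mu>. admissible \<mu>}"
  then have adm: "admissible \<mu>" by simp
  have "Q \<mu> \<le> measure (autocorrelation \<mu>) {1/4..3/4} / ((3/4 - 1/4) * (tv_norm \<mu>)\<^sup>2)"
    unfolding Q_def by (rule cINF_lower2[OF bdd_below_Q, of "(3/4, 1/4)"]) auto
  also have "\<dots> \<le> 2"
    using measure_autocorrelation_le[OF adm, of "{1/4..3/4}"]
    by (cases "tv_norm \<mu> = 0") (auto simp: field_simps)
  finally show "Q \<mu> \<le> 2" .
qed

lemma y0_is_least:
  "y0 > 0" "y0 = tan y0" "\<And>y. y > 0 \<Longrightarrow> y = tan y \<Longrightarrow> y0 \<le> y"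
proof -
  define f :: "real \<Rightarrow> real" where "f = (\<lambda>y. sin y - y * cos y)"
  define S where "S = {y \<in> {pi..3 * pi / 2}. f y = 0}"
  have root_iff: "y = tan y \<longleftrightarrow> f y = 0" if "y > 0" for y
    using that sin_zero_abs_cos_one[of y] by (cases "cos y = 0") (auto simp: f_def tan_def field_simps)
  have f_pos: "f y > 0" if "0 < y" "y \<le> pi" for y
  proof -
    have "f 0 < f y"
    proof (rule DERIV_pos_imp_increasing_open[OF that(1)])
      fix x assume "0 < x" "x < y"
      have "DERIV f x :> x * sin x"
        unfolding f_def by (auto intro!: derivative_eq_intros)
      moreover have "x * sin x > 0" using \<open>0 < x\<close> \<open>x < y\<close> that by (simp add: sin_gt_zero)
      ultimately show "\<exists>d. DERIV f x :> d \<and> d > 0" by blast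
    qed (auto simp: f_def intro!: continuous_intros)
    then show ?thesis by (simp add: f_def)
  qed
  have cont: "continuous_on A f" for A unfolding f_def by (intro continuous_intros)
  have "cos (3 * pi / 2) = 0" "sin (3 * pi / 2) = -1"
    using cos_3over2_pi sin_3over2_pi by (simp_all add: field_simps)
  then have "f (3 * pi / 2) \<le> 0" "f pi \<ge> 0" by (simp_all add: f_def)
  then have "S \<noteq> {}"
    using IVT2'[of f "3 * pi / 2" 0 pi, OF _ _ _ cont] by (auto simp: S_def)
  have "closed S"
    unfolding S_def by (intro continuous_closed_preimage_constant cont) auto
  moreover have "{pi..3 * pi / 2} \<inter> S = S" unfolding S_def by blast
  ultimately have "compact S"
    using compact_Int_closed[of "{pi..3 * pi / 2}" S] by simp
  then obtain t where t: "t \<in> S" "\<And>y. y \<in> S \<Longrightarrow> t \<le> y"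
    using compact_attains_inf \<open>S \<noteq> {}\<close> by metis
  have t0: "t > 0" "t = tan t" using t(1) root_iff[of t] pi_gt_zero by (auto simp: S_def simp del: pi_gt_zero)
  have tmin: "t \<le> y" if "y > 0" "y = tan y" for y
  proof (cases "y \<le> 3 * pi / 2")
    case True
    then have "y \<in> S" using that f_pos[of y] root_iff[of y] by (force simp: S_def)
    then show ?thesis by (rule t(2))
  next
    case False
    then show ?thesis using t(1) by (auto simp: S_def)
  qed
  have "y0 = t" unfolding y0_def by (rule Least_equality) (use t0 tmin in auto)
  then show "y0 > 0" "y0 = tan y0" "\<And>y. y > 0 \<Longrightarrow> y = tan y \<Longrightarrow> y0 \<le> y"
    using t0 tmin by auto
qed

end

theory Submission
  imports Defs
begin

text \<open>
  Let \<open>c = Q \<mu> \<parallel>\<mu>\<parallel>\<^sup>2\<close> and suppose \<open>Q \<mu> \<ge> 1 / (2 (1 + \<theta>0))\<close>. The autocorrelation \<open>\<rho>\<close> dominates \<open>\<sigma>\<close>,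
  which is \<open>c\<close> times Lebesgue measure on \<open>[-1, 1]\<close>; write \<open>\<rho> = \<sigma> + V\<close>. As \<open>\<rho>\<close> has Fourier
  transform \<open>\<bar>char \<mu>\<bar>\<^sup>2 \<ge> 0\<close>, integrating \<open>1 - cos (y0 x)\<close> forces equality: \<open>char \<mu> y0 = 0\<close>, and \<open>V\<close>
  lives on the lattice \<open>Z = (2 \<pi> / y0) \<int>\<close>. Split \<open>\<mu>\<close> into its atomic part \<open>\<mu>a\<close>, of mass \<open>a\<close>, and the
  rest \<open>\<mu>c\<close>. The autocorrelation of \<open>\<mu>a\<close> lives on \<open>Z\<close>, so \<open>\<bar>char \<mu>a y0\<bar> = a = \<bar>char \<mu>c y0\<bar>\<close>, whereas
  that of \<open>\<mu>c\<close> is at most \<open>\<sigma>\<close>. Testing the latter against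
  \<open>(1 + cos)(1 + 2 cos)\<^sup>2 (y0 x) = 5 + 8 cos (y0 x) + 4 cos (2 y0 x) + cos (3 y0 x)\<close>
  contradicts \<open>1/5 < \<theta>0 < 1\<close>. So \<open>Q \<mu> < 1 / (2 (1 + \<theta>0))\<close> for every \<open>\<mu>\<close>.

  A tight extremizing sequence has a weak limit point by Helly's theorem. The autocorrelations
  converge along with the measures, because their characteristic functions are
  \<open>\<bar>char \<mu>\<bar>\<^sup>2\<close>, and their masses on closed intervals are upper semicontinuous; hence the limit
  point is a maximizer.
\<close>

subsection \<open>Decomposition of Borel measures\<close>

text \<open>The difference of the two distribution functions is nondecreasing and right-continuous,
  so \<open>V\<close> can be taken as its Stieltjes measure. The identity then holds on half-open
  intervals and spreads to all Borel sets by Dynkin's argument.\<close>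

lemma finite_borel_measure_decomp:
  assumes N: "finite_borel_measure N" and S: "finite_borel_measure S"
    and le: "\<And>x y. x < y \<Longrightarrow> measure S {x<..y} \<le> measure N {x<..y}"
  obtains V where "finite_borel_measure V"
    "\<And>A. A \<in> sets borel \<Longrightarrow> emeasure N A = emeasure S A + emeasure V A"
proof -
  interpret N: finite_borel_measure N by fact
  interpret S: finite_borel_measure S by fact
  define F where "F x = cdf N x - cdf S x" for x
  have mono: "F x \<le> F y" if "x \<le> y" for x y
    using le[of x y] N.cdf_diff_eq[of x y] S.cdf_diff_eq[of x y] that
    by (cases "x = y") (auto simp: F_def)
  have rc: "continuous (at_right a) F" for a
    unfolding F_def by (intro continuous_intros N.cdf_is_right_cont S.cdf_is_right_cont)
  define m where "m = measure N (space N) - measure S (space S)"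
  have bot: "(F \<longlongrightarrow> 0) at_bot"
    unfolding F_def using tendsto_diff[OF N.cdf_lim_at_bot S.cdf_lim_at_bot] by simp
  have top: "(F \<longlongrightarrow> m) at_top"
    unfolding F_def m_def by (intro tendsto_diff N.cdf_lim_at_top S.cdf_lim_at_top)
  have "F x \<ge> 0" for x
    by (rule tendsto_upperbound[OF bot])
       (auto simp: eventually_at_bot_linorder intro!: exI[of _ x] mono)
  then have m: "m \<ge> 0"
    by (intro tendsto_lowerbound[OF top]) auto
  define V where "V = interval_measure F"
  interpret V: finite_borel_measure V
    unfolding V_def by (rule finite_borel_measure_interval_measure[OF mono rc bot top m])
  have VU: "emeasure V UNIV = ennreal m"
    unfolding V_def by (rule interval_measure_UNIV[OF mono rc bot top m])
  have UNIV: "emeasure N UNIV = emeasure S UNIV + emeasure V UNIV"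
    using m N.borel_UNIV S.borel_UNIV VU
    by (simp add: m_def N.emeasure_eq_measure S.emeasure_eq_measure flip: ennreal_plus)
  have "emeasure N A = emeasure S A + emeasure V A" if "A \<in> sets borel" for A
  proof -
    have "Int_stable (range (\<lambda>(a, b). {a<..b::real}))" by (auto simp: Int_stable_def)
    moreover have "range (\<lambda>(a, b). {a<..b::real}) \<subseteq> Pow UNIV" by auto
    moreover have "A \<in> sigma_sets UNIV (range (\<lambda>(a, b). {a<..b::real}))"
      using that by (simp add: borel_sigma_sets_Ioc)
    ultimately show ?thesis
    proof (induction rule: sigma_sets_induct_disjoint)
      case (basic A)
      then obtain a b where A: "A = {a<..b}" by auto
      show ?case
      proof (cases "a \<le> b")
        case True
        then show ?thesis unfolding A V_def
          using mono[of a b] S.cdf_nondecreasing[of a b]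
          by (simp add: emeasure_interval_measure_Ioc[OF True mono rc] N.emeasure_Ioc S.emeasure_Ioc
              F_def flip: ennreal_plus)
      qed (simp add: A)
    next
      case (compl A)
      then have A: "A \<in> sets borel" by (simp add: borel_sigma_sets_Ioc)
      have mS: "measure S A \<le> measure S UNIV" and mV: "measure V A \<le> measure V UNIV"
        by (auto intro!: S.finite_measure_mono V.finite_measure_mono)
      have "emeasure M (UNIV - A) = emeasure M UNIV - emeasure M A"
        if "finite_borel_measure M" for M
      proof -
        interpret M: finite_borel_measure M by fact
        show ?thesis using emeasure_compl[of A M] A M.borel_UNIV by auto
      qed
      from this[OF N] this[OF S] this[OF V.finite_borel_measure_axioms]
      show ?case
        using compl UNIV mS mV
        by (simp add: N.emeasure_eq_measure S.emeasure_eq_measure V.emeasure_eq_measure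
             ennreal_minus flip: ennreal_plus)
    next
      case (union A)
      then have A: "A i \<in> sets borel" for i by (auto simp: borel_sigma_sets_Ioc)
      have "emeasure M (\<Union>i. A i) = (\<Sum>i. emeasure M (A i))" if "finite_borel_measure M" for M
        using union(1) A that
        by (intro suminf_emeasure[symmetric]) (auto simp: finite_borel_measure.M_is_borel)
      from this[OF N] this[OF S] this[OF V.finite_borel_measure_axioms]
      show ?case using union.IH by (simp add: suminf_add)
    qed simp
  qed
  with V.finite_borel_measure_axioms that show ?thesis by blast
qed

lemma nn_integral_add_measure:
  assumes sN: "sets N = sets M" and sV: "sets V = sets M"
    and eq: "\<And>A. A \<in> sets M \<Longrightarrow> emeasure N A = emeasure M A + emeasure V A"
    and f: "f \<in> borel_measurable M"
  shows "(\<integral>\<^sup>+x. f x \<partial>N) = (\<integral>\<^sup>+x. f x \<partial>M) + (\<integral>\<^sup>+x. f x \<partial>V)"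
proof -
  note [measurable_cong] = sN sV
  have sp: "space N = space M" "space V = space M"
    using sN sV by (auto dest: sets_eq_imp_space_eq)
  show ?thesis using f
  proof (induction rule: borel_measurable_induct)
    case (cong f g)
    have "(\<integral>\<^sup>+x. f x \<partial>L) = (\<integral>\<^sup>+x. g x \<partial>L)" if "space L = space M" for L
      using cong(3) that by (intro nn_integral_cong) auto
    from this[OF refl] this[OF sp(1)] this[OF sp(2)] cong(4) show ?case by simp
  next
    case (set A)
    then show ?case using eq sN sV by simp
  next
    case (mult u c)
    then show ?case by (simp add: nn_integral_cmult distrib_left)
  next
    case (add u v)
    then show ?case by (simp add: nn_integral_add ac_simps)
  next
    case (seq U)
    then have [measurable]: "U i \<in> borel_measurable M" for i by simp
    have *: "(\<integral>\<^sup>+x. (SUP i. U i) x \<partial>L) = (SUP i. \<integral>\<^sup>+x. U i x \<partial>L)"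
      if "sets L = sets M" for L
      unfolding SUP_apply
      by (rule nn_integral_monotone_convergence_SUP) (use seq that in \<open>auto cong: measurable_cong_sets\<close>)
    have "(SUP i. (\<integral>\<^sup>+x. U i x \<partial>M) + (\<integral>\<^sup>+x. U i x \<partial>V)) =
        (SUP i. \<integral>\<^sup>+x. U i x \<partial>M) + (SUP i. \<integral>\<^sup>+x. U i x \<partial>V)"
      using seq by (intro ennreal_SUP_add) (auto simp: incseq_def le_fun_def intro!: nn_integral_mono)
    then show ?case by (simp only: *[OF sN] *[OF sV] *[OF refl] seq.IH)
  qed
qed

subsection \<open>Autocorrelations and their Fourier transforms\<close>

lemma finite_borel_measure_autocorrelation:
  assumes "finite_borel_measure \<mu>"
  shows "finite_borel_measure (autocorrelation \<mu>)"
proof -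
  interpret finite_borel_measure \<mu> by fact
  note [measurable_cong] = M_is_borel
  interpret F: finite_measure "\<mu> \<Otimes>\<^sub>M \<mu>" by (intro finite_measure_pair_measure) unfold_locales
  have f[measurable]: "(\<lambda>(x, y). x - y) \<in> measurable (\<mu> \<Otimes>\<^sub>M \<mu>) borel" by measurable
  interpret D: finite_measure "autocorrelation \<mu>"
    unfolding autocorrelation_def by (rule F.finite_measure_distr[OF f])
  show ?thesis by unfold_locales (simp add: autocorrelation_def)
qed

lemma nn_integral_autocorrelation:
  assumes "finite_borel_measure \<mu>" and [measurable]: "f \<in> borel_measurable borel"
  shows "(\<integral>\<^sup>+z. f z \<partial>autocorrelation \<mu>) = (\<integral>\<^sup>+x. \<integral>\<^sup>+y. f (x - y) \<partial>\<mu> \<partial>\<mu>)"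
proof -
  interpret finite_borel_measure \<mu> by fact
  note [measurable_cong] = M_is_borel
  have "(\<integral>\<^sup>+z. f z \<partial>autocorrelation \<mu>) = (\<integral>\<^sup>+z. f (case z of (x, y) \<Rightarrow> x - y) \<partial>(\<mu> \<Otimes>\<^sub>M \<mu>))"
    unfolding autocorrelation_def by (rule nn_integral_distr) auto
  also have "\<dots> = (\<integral>\<^sup>+x. \<integral>\<^sup>+y. f (x - y) \<partial>\<mu> \<partial>\<mu>)"
    by (subst nn_integral_fst[symmetric]) auto
  finally show ?thesis .
qed

lemma emeasure_autocorrelation_eq:
  assumes "finite_borel_measure \<mu>" and "A \<in> sets borel"
  shows "emeasure (autocorrelation \<mu>) A = (\<integral>\<^sup>+x. \<integral>\<^sup>+y. indicator A (x - y) \<partial>\<mu> \<partial>\<mu>)"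
  using nn_integral_autocorrelation[OF assms(1), of "indicator A"] assms(2)
  by (simp add: autocorrelation_def)

lemma emeasure_autocorrelation_UNIV:
  assumes "finite_borel_measure \<mu>"
  shows "emeasure (autocorrelation \<mu>) UNIV = emeasure \<mu> UNIV * emeasure \<mu> UNIV"
proof -
  interpret finite_borel_measure \<mu> by fact
  show ?thesis using emeasure_autocorrelation_eq[OF assms, of UNIV] borel_UNIV by simp
qed

lemma measure_autocorrelation_UNIV:
  assumes "finite_borel_measure \<mu>"
  shows "measure (autocorrelation \<mu>) UNIV = (measure \<mu> UNIV)\<^sup>2"
  using emeasure_autocorrelation_UNIV[OF assms]
  by (simp add: measure_def enn2real_mult power2_eq_square)

text \<open>Reflection amounts to exchanging the two variables of integration. Since
  \<open>Q\<close> only tests intervals inside (0, 1), this symmetry supplies the information on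
  (-1, 0).\<close>

lemma emeasure_autocorrelation_uminus:
  assumes \<mu>: "finite_borel_measure \<mu>" and A[measurable]: "A \<in> sets borel"
  shows "emeasure (autocorrelation \<mu>) (uminus -` A) = emeasure (autocorrelation \<mu>) A"
proof -
  interpret finite_borel_measure \<mu> by fact
  note [measurable_cong] = M_is_borel
  interpret pair_sigma_finite \<mu> \<mu> ..
  have "emeasure (autocorrelation \<mu>) (uminus -` A) = (\<integral>\<^sup>+x. \<integral>\<^sup>+y. indicator A (y - x) \<partial>\<mu> \<partial>\<mu>)"
    by (subst emeasure_autocorrelation_eq[OF \<mu>])
       (auto simp: indicator_def intro!: measurable_sets_borel[of _ borel])
  also have "\<dots> = (\<integral>\<^sup>+x. \<integral>\<^sup>+y. indicator A (x - y) \<partial>\<mu> \<partial>\<mu>)"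
    by (rule Fubini') measurable
  finally show ?thesis by (simp add: emeasure_autocorrelation_eq[OF \<mu> A])
qed

text \<open>By Fubini, the exponential of a difference factors into \<open>char \<mu> t\<close> and
  its conjugate. This is the source of all positivity used below.\<close>

lemma char_autocorrelation:
  assumes \<mu>: "finite_borel_measure \<mu>"
  shows "char (autocorrelation \<mu>) t = of_real ((cmod (char \<mu> t))\<^sup>2)"
proof -
  interpret finite_borel_measure \<mu> by fact
  note [measurable_cong] = M_is_borel
  interpret pair_sigma_finite \<mu> \<mu> ..
  interpret F: finite_measure "\<mu> \<Otimes>\<^sub>M \<mu>" by (intro finite_measure_pair_measure) unfold_locales
  have int: "integrable (\<mu> \<Otimes>\<^sub>M \<mu>) (\<lambda>(x, y). iexp (t * (x - y)))"
    by (rule F.integrable_const_bound[of _ 1]) (auto simp del: of_real_mult of_real_diff)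
  have "char (autocorrelation \<mu>) t = (CLINT z|\<mu> \<Otimes>\<^sub>M \<mu>. iexp (t * (case z of (x, y) \<Rightarrow> x - y)))"
    unfolding char_def autocorrelation_def by (rule integral_distr) auto
  also have "\<dots> = (CLINT z|\<mu> \<Otimes>\<^sub>M \<mu>. (case z of (x, y) \<Rightarrow> iexp (t * (x - y))))"
    by (intro Bochner_Integration.integral_cong) (auto split: prod.split)
  also have "\<dots> = (CLINT x|\<mu>. CLINT y|\<mu>. iexp (t * (x - y)))"
    using integral_fst'[OF int] by simp
  also have "\<dots> = (CLINT x|\<mu>. CLINT y|\<mu>. iexp (t * x) * cnj (iexp (t * y)))"
    by (simp add: exp_cnj ring_distribs flip: exp_add)
  also have "\<dots> = char \<mu> t * cnj (char \<mu> t)"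
    unfolding char_def by (simp add: integral_cnj del: of_real_mult)
  finally show ?thesis by (simp only: complex_norm_square)
qed

lemma integral_cos_autocorrelation:
  assumes \<mu>: "finite_borel_measure \<mu>"
  shows "integrable (autocorrelation \<mu>) (\<lambda>x. cos (t * x))"
    and "(\<integral>x. cos (t * x) \<partial>autocorrelation \<mu>) = (cmod (char \<mu> t))\<^sup>2"
proof -
  interpret finite_borel_measure "autocorrelation \<mu>"
    by (rule finite_borel_measure_autocorrelation[OF \<mu>])
  note [measurable_cong] = M_is_borel
  show "integrable (autocorrelation \<mu>) (\<lambda>x. cos (t * x))"
    by (rule integrable_const_bound[of _ 1]) auto
  have "integrable (autocorrelation \<mu>) (\<lambda>x. iexp (t * x))"
    by (rule integrable_const_bound[of _ 1]) (auto simp del: of_real_mult)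
  from integral_Re[OF this] have "(\<integral>x. cos (t * x) \<partial>autocorrelation \<mu>) = Re (char (autocorrelation \<mu>) t)"
    by (simp add: char_def Re_exp)
  then show "(\<integral>x. cos (t * x) \<partial>autocorrelation \<mu>) = (cmod (char \<mu> t))\<^sup>2"
    by (simp add: char_autocorrelation[OF \<mu>])
qed

subsection \<open>The numbers \<open>y0\<close> and \<open>\<theta>0\<close>\<close>

lemma sin_y0: "sin y0 = y0 * cos y0"
  \<comment> \<open>If the cosine vanished, the convention \<open>x / 0 = 0\<close> would give
    \<open>tan y0 = 0\<close>, contrary to \<open>y0 > 0\<close>.\<close>
  using y0_is_least(1,2) by (cases "cos y0 = 0") (auto simp: tan_def field_simps)

lemma cos_y0: "cos y0 = - \<theta>0"
  using sin_y0 y0_is_least(1) by (simp add: \<theta>0_def)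

text \<open>The function sin y - y cos y vanishes at 0 and has derivative y sin y, positive on the
  open interval from 0 to pi. Hence it has no zero in (0, pi].\<close>

lemma pi_less_y0: "pi < y0"
proof (rule ccontr)
  assume "\<not> pi < y0"
  define f :: "real \<Rightarrow> real" where "f = (\<lambda>y. sin y - y * cos y)"
  have "f 0 < f y0"
  proof (rule DERIV_pos_imp_increasing_open[OF y0_is_least(1)])
    fix x assume "0 < x" "x < y0"
    have "DERIV f x :> x * sin x"
      unfolding f_def by (auto intro!: derivative_eq_intros)
    moreover have "x * sin x > 0"
      using \<open>0 < x\<close> \<open>x < y0\<close> \<open>\<not> pi < y0\<close> by (simp add: sin_gt_zero)
    ultimately show "\<exists>d. DERIV f x :> d \<and> d > 0" by blast
  qed (auto simp: f_def intro!: continuous_intros)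
  then show False by (simp add: f_def sin_y0)
qed

text \<open>The same function changes sign between pi and 3 pi / 2. A zero there is not a pole of
  the tangent, since sine and cosine would both vanish, so it is a solution of y = tan y.\<close>

lemma y0_le: "y0 \<le> 3 * pi / 2"
proof -
  define f :: "real \<Rightarrow> real" where "f = (\<lambda>y. sin y - y * cos y)"
  have v: "cos (3 * pi / 2) = 0" "sin (3 * pi / 2) = -1"
    using cos_3over2_pi sin_3over2_pi by (simp_all add: field_simps)
  then have "f (3 * pi / 2) \<le> 0" "f pi \<ge> 0" by (simp_all add: f_def)
  moreover have "continuous_on {pi..3 * pi / 2} f" unfolding f_def by (intro continuous_intros)
  ultimately obtain t where t: "pi \<le> t" "t \<le> 3 * pi / 2" "f t = 0"
    using IVT2'[of f "3 * pi / 2" 0 pi] by auto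
  have "cos t \<noteq> 0"
    using t(3) sin_zero_abs_cos_one[of t] by (auto simp: f_def)
  then have "t = tan t" using t(3) by (simp add: f_def tan_def field_simps)
  with t y0_is_least(3)[of t] pi_gt_zero show ?thesis by linarith
qed

text \<open>Machin's formula, with the first arctangent bounded by its argument and the second
  dropped.\<close>

lemma pi_le: "pi \<le> 16 / 5"
proof -
  have "arctan (1/5) \<le> 1/5" by (rule arctan_le_self) simp
  moreover have "arctan (1/239) \<ge> 0" by simp
  ultimately show ?thesis using machin by linarith
qed

text \<open>The sign comes from the sine being negative between pi and 3 pi / 2. The size comes from
  \<open>\<theta>0\<^sup>2 * (1 + y0\<^sup>2) = 1\<close>: the lower bound asks for
  \<open>y0\<^sup>2 < 24\<close>, and \<open>y0 \<le> 24/5\<close> suffices.\<close>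

lemma \<theta>0_bounds: "1/5 < \<theta>0" "\<theta>0 < 1"
proof -
  have "sin (y0 - pi) > 0"
    using pi_less_y0 y0_le pi_gt_zero by (intro sin_gt_zero) linarith+
  then have "sin y0 < 0" by (simp add: sin_diff)
  then have pos: "\<theta>0 > 0" using divide_neg_pos[OF _ y0_is_least(1)] by (simp add: \<theta>0_def)
  have eq: "\<theta>0\<^sup>2 * (1 + y0\<^sup>2) = 1"
    using sin_cos_squared_add[of y0] sin_y0 by (simp add: cos_y0 power_mult_distrib algebra_simps)
  have "y0 \<le> 24/5" using y0_le pi_le by simp
  then have "y0\<^sup>2 \<le> (24/5)\<^sup>2" using y0_is_least(1) by (intro power_mono) auto
  then have y: "1 + y0\<^sup>2 < 25" by (simp add: power2_eq_square)
  show "1/5 < \<theta>0"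
  proof (rule ccontr)
    assume "\<not> 1/5 < \<theta>0"
    then have "\<theta>0\<^sup>2 \<le> (1/5)\<^sup>2" using pos by (intro power_mono) auto
    then have "\<theta>0\<^sup>2 * (1 + y0\<^sup>2) \<le> (1/5)\<^sup>2 * (1 + y0\<^sup>2)"
      by (intro mult_right_mono) auto
    also have "\<dots> < 1" using y by (simp add: power2_eq_square)
    finally show False using eq by simp
  qed
  show "\<theta>0 < 1"
  proof (rule ccontr)
    assume "\<not> \<theta>0 < 1"
    then have "1 * (1 + y0\<^sup>2) \<le> \<theta>0\<^sup>2 * (1 + y0\<^sup>2)" by (intro mult_right_mono) auto
    then show False using eq y0_is_least(1) by simp
  qed
qed

subsection \<open>Domination of a multiple of Lebesgue measure\<close>

lemma finite_borel_measureI: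
  assumes "sets M = sets borel" and "emeasure M UNIV < \<infinity>"
  shows "finite_borel_measure M"
proof -
  have "finite_measure M"
    using assms(2) sets_eq_imp_space_eq[OF assms(1)] by (intro finite_measureI) auto
  then show ?thesis
    using assms(1) by (simp add: finite_borel_measure_def finite_borel_measure_axioms_def)
qed

lemma emeasure_density_cmult_indicator:
  assumes [measurable]: "A \<in> sets M" "B \<in> sets M"
  shows "emeasure (density M (\<lambda>x. c * indicator B x)) A = c * emeasure M (A \<inter> B)"
proof -
  have "emeasure (density M (\<lambda>x. c * indicator B x)) A = (\<integral>\<^sup>+x. c * indicator (A \<inter> B) x \<partial>M)"
    by (subst emeasure_density) (auto simp: indicator_def intro!: nn_integral_cong)
  then show ?thesis by (simp add: nn_integral_cmult_indicator)
qed

text \<open>Closed intervals strictly inside (0, 1) exhaust half-open ones up to the endpoints. The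
  decomposition lemma then carries the comparison from half-open intervals to Borel sets.\<close>

lemma emeasure_ge_lborel:
  assumes N: "finite_borel_measure N" and c: "c \<ge> 0"
    and h: "\<And>a b. 0 < b \<Longrightarrow> b < a \<Longrightarrow> a < 1 \<Longrightarrow> c * (a - b) \<le> measure N {b..a}"
    and A: "A \<in> sets borel"
  shows "ennreal c * emeasure lborel (A \<inter> {0<..1}) \<le> emeasure N A"
proof -
  interpret N: finite_borel_measure N by fact
  define S where "S = density lborel (\<lambda>x. ennreal c * indicator {0<..1::real} x)"
  have S: "emeasure S B = ennreal c * emeasure lborel (B \<inter> {0<..1})" if "B \<in> sets borel" for B
    unfolding S_def using that by (intro emeasure_density_cmult_indicator) auto
  have Ioc: "emeasure S {x<..y} = ennreal (c * (if max x 0 < min y 1 then min y 1 - max x 0 else 0))" for x y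
  proof -
    have **: "emeasure lborel {u<..v} = ennreal (if u < v then v - u else 0)" for u v :: real
      by simp
    have *: "{x<..y} \<inter> {0<..1} = {max x 0<..min y 1}" by auto
    show ?thesis unfolding S[of "{x<..y}", simplified] *
      unfolding ennreal_mult'[OF c] **[symmetric] ..
  qed
  have "finite_borel_measure S"
    using S[of UNIV] by (intro finite_borel_measureI) (simp_all add: S_def)
  moreover have "measure S {x<..y} \<le> measure N {x<..y}" if "x < y" for x y
  proof (cases "max x 0 < min y 1")
    case True
    define u v where "u = max x 0" and "v = min y 1"
    have uv: "u < v" using True by (simp add: u_def v_def)
    have "c * (v - u) \<le> measure N {x<..y}"
    proof (rule field_le_mult_one_interval)
      fix z :: real assume z: "0 < z" "z < 1"
      \<comment> \<open>Cutting off \<open>e\<close> at both ends scales the length of the interval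
        by exactly \<open>z\<close> and moves it strictly inside (0, 1).\<close>
      define e where "e = (1 - z) * (v - u) / 2"
      have e: "e > 0" using z uv by (simp add: e_def)
      have ve: "(v - e) - (u + e) = z * (v - u)" by (simp add: e_def field_simps)
      moreover have "z * (v - u) > 0" using z uv by simp
      ultimately have "u + e < v - e" by linarith
      then have "c * ((v - e) - (u + e)) \<le> measure N {u + e..v - e}"
        using e by (intro h) (auto simp: u_def v_def)
      also have "\<dots> \<le> measure N {x<..y}"
        using e by (intro N.finite_measure_mono) (auto simp: u_def v_def)
      finally show "z * (c * (v - u)) \<le> measure N {x<..y}" by (simp add: ve mult_ac)
    qed
    then show ?thesis using Ioc[of x y] uv c unfolding measure_def[of S] by (simp add: u_def v_def)
  next
    case False
    then have "measure S {x<..y} = 0" using Ioc[of x y] unfolding measure_def[of S] if_not_P[OF False] by simp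
    then show ?thesis by simp
  qed
  ultimately obtain V where "\<And>A. A \<in> sets borel \<Longrightarrow> emeasure N A = emeasure S A + emeasure V A"
    using finite_borel_measure_decomp[OF N] by blast
  then show ?thesis using A S[OF A] by simp
qed

definition box_measure :: "real \<Rightarrow> real measure" where
  "box_measure c = density lborel (\<lambda>x. ennreal c * indicator {-1..1} x)"

lemma sets_box_measure [simp, measurable_cong]: "sets (box_measure c) = sets borel"
  by (simp add: box_measure_def)

lemma emeasure_box_measure:
  "A \<in> sets borel \<Longrightarrow> emeasure (box_measure c) A = ennreal c * emeasure lborel (A \<inter> {-1..1})"
  unfolding box_measure_def by (intro emeasure_density_cmult_indicator) auto

lemma finite_borel_measure_box_measure: "finite_borel_measure (box_measure c)"
  using emeasure_box_measure[of UNIV c]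
  by (intro finite_borel_measureI) (simp_all add: ennreal_mult_less_top)

lemma nn_integral_box_measure:
  assumes [measurable]: "f \<in> borel_measurable borel" and nn: "\<And>x. f x \<ge> 0"
    and F: "\<And>x. DERIV F x :> f x" and c: "c \<ge> 0"
  shows "(\<integral>\<^sup>+x. ennreal (f x) \<partial>box_measure c) = ennreal (c * (F 1 - F (-1)))"
proof -
  have "(\<integral>\<^sup>+x. ennreal (f x) \<partial>box_measure c) = (\<integral>\<^sup>+x. ennreal c * (ennreal (f x) * indicator {-1..1} x) \<partial>lborel)"
    unfolding box_measure_def by (subst nn_integral_density) (auto simp: mult_ac)
  also have "\<dots> = ennreal c * ennreal (F 1 - F (-1))"
    by (subst nn_integral_cmult) (auto simp: nn_integral_FTC_Icc[of f _ _ F] F nn)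
  finally show ?thesis using c by (simp add: ennreal_mult')
qed

text \<open>The bound on (0, 1] is carried to [-1, 0) by reflection, and the remaining point 0 is
  Lebesgue-null.\<close>

lemma box_measure_le:
  assumes N: "finite_borel_measure N" and c: "c \<ge> 0"
    and h: "\<And>a b. 0 < b \<Longrightarrow> b < a \<Longrightarrow> a < 1 \<Longrightarrow> c * (a - b) \<le> measure N {b..a}"
    and sym: "\<And>A. A \<in> sets borel \<Longrightarrow> emeasure N (uminus -` A) = emeasure N A"
    and A[measurable]: "A \<in> sets borel"
  shows "emeasure (box_measure c) A \<le> emeasure N A"
proof -
  interpret N: finite_borel_measure N by fact
  note [measurable_cong] = N.M_is_borel
  define A1 A2 where "A1 = A \<inter> {0<..1}" and "A2 = A \<inter> {-1..<0}"
  have [measurable]: "A1 \<in> sets borel" "A2 \<in> sets borel" by (auto simp: A1_def A2_def)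
  have m: "uminus -` A2 \<in> sets borel" by (auto intro!: measurable_sets_borel[of _ borel])
  have 1: "ennreal c * emeasure lborel A1 \<le> emeasure N A1"
    using emeasure_ge_lborel[OF N c h, of A1] by (simp add: A1_def Int_assoc)
  have "ennreal c * emeasure lborel (uminus -` A2 \<inter> {0<..1}) \<le> emeasure N (uminus -` A2)"
    using emeasure_ge_lborel[OF N c h m] .
  also have "uminus -` A2 \<inter> {0<..1} = uminus -` A2" by (auto simp: A2_def)
  also have "emeasure lborel (uminus -` A2) = emeasure lborel A2"
    by (subst (2) lborel_distr_uminus[symmetric], subst emeasure_distr) auto
  finally have 2: "ennreal c * emeasure lborel A2 \<le> emeasure N A2"
    using sym[of A2] by simp
  have "emeasure lborel (A \<inter> {-1..1}) \<le> emeasure lborel (A1 \<union> A2 \<union> {0})"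
    by (intro emeasure_mono) (auto simp: A1_def A2_def)
  also have "\<dots> \<le> emeasure lborel (A1 \<union> A2) + emeasure lborel {0::real}"
    by (intro emeasure_subadditive) auto
  also have "\<dots> \<le> emeasure lborel A1 + emeasure lborel A2"
    by (simp add: emeasure_subadditive)
  finally have "emeasure (box_measure c) A \<le> ennreal c * (emeasure lborel A1 + emeasure lborel A2)"
    unfolding emeasure_box_measure[OF A] by (intro mult_left_mono) auto
  also have "\<dots> \<le> emeasure N A1 + emeasure N A2"
    using 1 2 by (simp add: distrib_left add_mono)
  also have "\<dots> = emeasure N (A1 \<union> A2)"
    by (intro plus_emeasure) (auto simp: A1_def A2_def)
  also have "\<dots> \<le> emeasure N A"
    by (intro emeasure_mono) (auto simp: A1_def A2_def)
  finally show ?thesis .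
qed

lemma Q_le_measure:
  assumes "0 < b" "b < a" "a < 1" and tv: "tv_norm \<mu> > 0"
  shows "Q \<mu> * (tv_norm \<mu>)\<^sup>2 * (a - b) \<le> measure (autocorrelation \<mu>) {b..a}"
proof -
  have "Q \<mu> \<le> measure (autocorrelation \<mu>) {b..a} / ((a - b) * (tv_norm \<mu>)\<^sup>2)"
    unfolding Q_def by (rule cINF_lower2[OF bdd_below_Q, of "(a, b)"]) (use assms in auto)
  then show ?thesis using assms by (simp add: field_simps)
qed

section \<open>Restrictions of a measure: autocorrelation and characteristic function\<close>

lemma autocorrelation_mono:
  assumes \<mu>: "finite_borel_measure \<mu>" and \<nu>: "finite_borel_measure \<nu>" and le: "\<nu> \<le> \<mu>"
    and A[measurable]: "A \<in> sets borel"
  shows "emeasure (autocorrelation \<nu>) A \<le> emeasure (autocorrelation \<mu>) A"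
proof -
  have s: "sets \<nu> = sets \<mu>"
    using \<mu> \<nu> by (simp add: finite_borel_measure.M_is_borel)
  have "(\<integral>\<^sup>+x. \<integral>\<^sup>+y. indicator A (x - y) \<partial>\<nu> \<partial>\<nu>) \<le> (\<integral>\<^sup>+x. \<integral>\<^sup>+y. indicator A (x - y) \<partial>\<mu> \<partial>\<nu>)"
    by (intro nn_integral_mono nn_integral_mono_measure s le)
  also have "\<dots> \<le> (\<integral>\<^sup>+x. \<integral>\<^sup>+y. indicator A (x - y) \<partial>\<mu> \<partial>\<mu>)"
    by (intro nn_integral_mono_measure s le)
  finally show ?thesis
    by (simp add: emeasure_autocorrelation_eq[OF \<mu> A] emeasure_autocorrelation_eq[OF \<nu> A])
qed

lemma finite_borel_measure_restrict:
  assumes "finite_borel_measure \<mu>" "B \<in> sets borel"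
  shows "finite_borel_measure (density \<mu> (indicator B))"
proof -
  interpret finite_borel_measure \<mu> by fact
  have "emeasure (density \<mu> (indicator B)) UNIV = emeasure \<mu> B"
    using emeasure_density_cmult_indicator[of UNIV \<mu> B 1] assms(2) by (simp add: M_is_borel)
  then show ?thesis
    by (intro finite_borel_measureI) (simp_all add: M_is_borel emeasure_eq_measure)
qed

lemma density_indicator_le:
  assumes [measurable]: "B \<in> sets M"
  shows "density M (indicator B) \<le> M"
proof (subst le_measure)
  show "\<forall>A\<in>sets (density M (indicator B)). emeasure (density M (indicator B)) A \<le> emeasure M A"
    using emeasure_density_cmult_indicator[of _ M B 1]
    by (auto intro!: emeasure_mono)
qed simp

lemma char_density_split:
  assumes \<mu>: "finite_borel_measure \<mu>" and B[measurable]: "B \<in> sets borel"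
  shows "char \<mu> t = char (density \<mu> (indicator B)) t + char (density \<mu> (indicator (- B))) t"
proof -
  interpret finite_borel_measure \<mu> by fact
  note [measurable_cong] = M_is_borel
  have [simp, measurable]: "integrable \<mu> (\<lambda>x. iexp (t * x))"
    by (rule integrable_const_bound[of _ 1]) (auto simp del: of_real_mult)
  have *: "char (density \<mu> (indicator C)) t = (CLINT x|\<mu>. indicator C x *\<^sub>R iexp (t * x))"
    if [measurable]: "C \<in> sets borel" for C
  proof -
    have "density \<mu> (indicator C) = density \<mu> (\<lambda>x. ennreal (indicator C x))"
      by (simp add: ennreal_indicator)
    then show ?thesis unfolding char_def by (simp add: integral_density)
  qed
  have "char \<mu> t = (CLINT x|\<mu>. indicator B x *\<^sub>R iexp (t * x) + indicator (- B) x *\<^sub>R iexp (t * x))"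
    unfolding char_def by (intro Bochner_Integration.integral_cong) (auto simp: indicator_def)
  also have "\<dots> = (CLINT x|\<mu>. indicator B x *\<^sub>R iexp (t * x)) + (CLINT x|\<mu>. indicator (- B) x *\<^sub>R iexp (t * x))"
    by (intro Bochner_Integration.integral_add integrable_mult_indicator) (auto simp del: of_real_mult)
  finally show ?thesis by (simp add: *)
qed

lemma finite_borel_measure_admissible: "admissible \<mu> \<Longrightarrow> finite_borel_measure \<mu>"
  by (simp add: admissible_def finite_borel_measure_def finite_borel_measure_axioms_def)

lemma tv_norm_pos: "admissible \<mu> \<Longrightarrow> tv_norm \<mu> > 0"
  using finite_measure.emeasure_eq_measure[of \<mu> UNIV]
  by (auto simp: admissible_def tv_norm_def zero_less_measure_iff)

text \<open>The final numerical contradiction: \<open>r\<close> is the total mass, \<open>a\<close>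
  the atomic mass and \<open>t\<close> stands for \<open>\<theta>0\<close>. The left-hand side will
  be the integral of the test polynomial against \<open>\<sigma>\<close>, the right-hand side a
  lower bound for its integral against the autocorrelation of the nonatomic part.\<close>

lemma atomic_mass_inequality:
  fixes a r t c :: real
  assumes t: "1/5 < t" "t < 1" and r: "r > 0" and c: "c * (2 + 2 * t) = r\<^sup>2"
  shows "c * (10 - 46/3 * t + 8 * t^2 - 8/3 * t^3) < 5 * (r - a)\<^sup>2 + 8 * a\<^sup>2"
proof -
  \<comment> \<open>\<open>40/13 r\<^sup>2\<close> is the minimum of the right-hand side over \<open>a\<close>, attained at \<open>a = 5/13 r\<close>.\<close>
  have "10 - 46/3 * t + 8 * t^2 - 8/3 * t^3 < 40/13 * (2 + 2 * t)"
  proof -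
    \<comment> \<open>The square is bounded by its chord over [1/5, 1] and the cubic term is
      dropped. What is left is linear in \<open>t\<close> and follows from
      \<open>t > 1/5\<close>.\<close>
    have "(t - 1/5) * (1 - t) > 0" using t by simp
    then have "t^2 < 6/5 * t - 1/5" by (simp add: power2_eq_square field_simps)
    moreover have "t^3 \<ge> 0" using t by simp
    moreover have "10 - 46/3 * t + 8 * u - 8/3 * v < 40/13 * (2 + 2 * t)"
      if "u < 6/5 * t - 1/5" "v \<ge> 0" for u v :: real
      using that t by (simp add: field_simps)
    ultimately show ?thesis by blast
  qed
  moreover have "c > 0" using c r t by (metis add_pos_pos mult_pos_pos zero_less_mult_pos2 zero_less_power zero_less_numeral less_trans zero_less_divide_1_iff)
  ultimately have "c * (10 - 46/3 * t + 8 * t^2 - 8/3 * t^3) < c * (40/13 * (2 + 2 * t))"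
    by (intro mult_strict_left_mono) auto
  also have "\<dots> = 40/13 * (c * (2 + 2 * t))" by (simp only: mult_ac)
  also have "\<dots> = 40/13 * r\<^sup>2" unfolding c ..
  also have "\<dots> \<le> 40/13 * r\<^sup>2 + 13 * (a - 5/13 * r)\<^sup>2" by simp
  also have "\<dots> = 5 * (r - a)\<^sup>2 + 8 * a\<^sup>2" by (simp add: power2_eq_square field_simps)
  finally show ?thesis .
qed

subsection \<open>The strict bound\<close>

text \<open>The product shows nonnegativity; the sum is the form that can be integrated, with
  nonnegative coefficients.\<close>

lemma cos_product_expansion:
  "(1 + cos x) * (1 + 2 * cos x)\<^sup>2 = 5 + 8 * cos x + 4 * cos (2 * x) + cos (3 * x :: real)"
  unfolding cos_double_cos cos_treble_cos
  by (simp add: power2_eq_square power3_eq_cube algebra_simps)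

text \<open>The relation \<open>sin y0 = y0 * cos y0\<close> puts a factor \<open>y0\<close> into
  every sine, so that the integrals of the cosines over [-1, 1] become polynomials in
  \<open>\<theta>0\<close>.\<close>

lemma sin_multiples_y0:
  "sin (2 * y0) = 2 * y0 * \<theta>0\<^sup>2"
  "sin (3 * y0) = y0 * \<theta>0 * (1 - 4 * \<theta>0\<^sup>2)"
proof -
  show "sin (2 * y0) = 2 * y0 * \<theta>0\<^sup>2"
    by (simp add: sin_double sin_y0 cos_y0 power2_eq_square)
  have "sin (3 * y0) = sin (2 * y0 + y0)" by simp
  also have "\<dots> = sin y0 * (4 * (cos y0)\<^sup>2 - 1)"
    unfolding sin_add sin_double cos_double_cos
    by (simp add: power2_eq_square algebra_simps)
  finally have "sin (3 * y0) = sin y0 * (4 * (cos y0)\<^sup>2 - 1)" .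
  then show "sin (3 * y0) = y0 * \<theta>0 * (1 - 4 * \<theta>0\<^sup>2)"
    by (simp add: sin_y0 cos_y0 algebra_simps)
qed

lemma Q_less:
  assumes adm: "admissible \<mu>"
  shows "Q \<mu> < 1 / (2 * (1 + \<theta>0))"
proof (rule ccontr)
  assume "\<not> Q \<mu> < 1 / (2 * (1 + \<theta>0))"
  then have ge: "1 / (2 * (1 + \<theta>0)) \<le> Q \<mu>" by simp
  note \<mu> = finite_borel_measure_admissible[OF adm]
  interpret \<mu>: finite_borel_measure \<mu> by (rule \<mu>)
  note [measurable_cong] = \<mu>.M_is_borel
  define r where "r = measure \<mu> UNIV"
  have r: "r > 0" using tv_norm_pos[OF adm] by (simp add: r_def tv_norm_def)
  define \<rho> where "\<rho> = autocorrelation \<mu>"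
  have fb\<rho>: "finite_borel_measure \<rho>"
    unfolding \<rho>_def by (rule finite_borel_measure_autocorrelation[OF \<mu>])
  interpret \<rho>: finite_borel_measure \<rho> by (rule fb\<rho>)
  note [measurable_cong] = \<rho>.M_is_borel
  \<comment> \<open>With this \<open>c\<close> the definition of \<open>Q\<close> bounds the mass of
    \<open>{b..a}\<close> under \<open>\<rho>\<close> below by \<open>c * (a - b)\<close>, and the
    assumption to be refuted reads \<open>c * (2 + 2 * \<theta>0) \<ge> r\<^sup>2\<close>.\<close>
  define c where "c = Q \<mu> * r\<^sup>2"
  have c2: "c * (2 + 2 * \<theta>0) \<ge> r\<^sup>2"
  proof -
    have "1 \<le> Q \<mu> * (2 + 2 * \<theta>0)" using ge \<theta>0_bounds by (simp add: field_simps)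
    then have "1 * r\<^sup>2 \<le> Q \<mu> * (2 + 2 * \<theta>0) * r\<^sup>2" by (intro mult_right_mono) auto
    then show ?thesis by (simp add: c_def mult_ac)
  qed
  have c0: "c \<ge> 0"
  proof -
    have "1 / (2 * (1 + \<theta>0)) > 0" using \<theta>0_bounds by simp
    with ge have "Q \<mu> \<ge> 0" by linarith
    then show ?thesis by (simp add: c_def)
  qed
  define \<sigma> where "\<sigma> = box_measure c"
  have s\<sigma>[measurable_cong, simp]: "sets \<sigma> = sets borel" by (simp add: \<sigma>_def)
  have fb\<sigma>: "finite_borel_measure \<sigma>" by (simp add: \<sigma>_def finite_borel_measure_box_measure)
  interpret \<sigma>: finite_borel_measure \<sigma> by (rule fb\<sigma>)
  have \<sigma>\<rho>: "emeasure \<sigma> A \<le> emeasure \<rho> A" if "A \<in> sets borel" for A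
    unfolding \<sigma>_def
  proof (rule box_measure_le[OF fb\<rho> c0 _ _ that])
    fix a b :: real assume "0 < b" "b < a" "a < 1"
    then show "c * (a - b) \<le> measure \<rho> {b..a}"
      using Q_le_measure[of b a \<mu>] r by (simp add: c_def r_def tv_norm_def \<rho>_def)
  qed (simp add: \<rho>_def emeasure_autocorrelation_uminus[OF \<mu>])
  obtain V where fbV: "finite_borel_measure V"
    and V: "\<And>A. A \<in> sets borel \<Longrightarrow> emeasure \<rho> A = emeasure \<sigma> A + emeasure V A"
  proof (rule finite_borel_measure_decomp[OF fb\<rho> fb\<sigma>])
    fix x y :: real
    show "measure \<sigma> {x<..y} \<le> measure \<rho> {x<..y}"
      using \<sigma>\<rho>[of "{x<..y}"] by (simp add: \<sigma>.emeasure_eq_measure \<rho>.emeasure_eq_measure)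
  qed blast
  interpret V: finite_borel_measure V by (rule fbV)
  note [measurable_cong] = V.M_is_borel

  have f\<rho>: "(\<integral>\<^sup>+x. ennreal (1 - cos (y0 * x)) \<partial>\<rho>) = ennreal (r\<^sup>2 - (cmod (char \<mu> y0))\<^sup>2)"
    using integral_cos_autocorrelation[OF \<mu>, of y0, folded \<rho>_def]
      measure_autocorrelation_UNIV[OF \<mu>, folded \<rho>_def r_def] \<rho>.borel_UNIV
    by (subst nn_integral_eq_integral) auto
  have f\<sigma>: "(\<integral>\<^sup>+x. ennreal (1 - cos (y0 * x)) \<partial>\<sigma>) = ennreal (c * (2 + 2 * \<theta>0))"
  proof -
    have "(\<integral>\<^sup>+x. ennreal (1 - cos (y0 * x)) \<partial>\<sigma>) =
        ennreal (c * ((1 - sin (y0 * 1) / y0) - (-1 - sin (y0 * (-1)) / y0)))"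
      unfolding \<sigma>_def
      by (rule nn_integral_box_measure[where F = "\<lambda>x. x - sin (y0 * x) / y0", OF _ _ _ c0])
         (use y0_is_least(1) in \<open>auto intro!: derivative_eq_intros\<close>)
    then show ?thesis by (simp add: \<theta>0_def)
  qed
  have f: "(\<integral>\<^sup>+x. ennreal (1 - cos (y0 * x)) \<partial>\<rho>) =
      (\<integral>\<^sup>+x. ennreal (1 - cos (y0 * x)) \<partial>\<sigma>) + (\<integral>\<^sup>+x. ennreal (1 - cos (y0 * x)) \<partial>V)"
    by (rule nn_integral_add_measure) (auto simp: V V.M_is_borel \<rho>.M_is_borel)
  have "ennreal (c * (2 + 2 * \<theta>0)) \<le> ennreal (r\<^sup>2 - (cmod (char \<mu> y0))\<^sup>2)"
    using f unfolding f\<rho> f\<sigma> by simp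
  \<comment> \<open>\<open>ennreal\<close> truncates negative numbers to 0, so passing to the reals
    uses that the left-hand side is at least \<open>r\<^sup>2 > 0\<close>.\<close>
  then have "c * (2 + 2 * \<theta>0) \<le> r\<^sup>2 - (cmod (char \<mu> y0))\<^sup>2"
    using c2 zero_less_power[OF r, of 2] unfolding ennreal_le_iff2 by linarith
  then have "(cmod (char \<mu> y0))\<^sup>2 \<le> 0" and ceq: "c * (2 + 2 * \<theta>0) = r\<^sup>2"
    using c2 zero_le_power2[of "cmod (char \<mu> y0)"] by linarith+
  then have char0: "char \<mu> y0 = 0" by simp
  \<comment> \<open>The integrals over \<open>\<rho>\<close> and \<open>\<sigma>\<close> now both
    equal \<open>r\<^sup>2\<close>, which leaves nothing for \<open>V\<close>.\<close>
  have "(\<integral>\<^sup>+x. ennreal (1 - cos (y0 * x)) \<partial>V) = 0"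
    using f unfolding f\<rho> f\<sigma> by (simp add: char0 ceq)
  then have "AE x in V. ennreal (1 - cos (y0 * x)) = 0"
    by (subst (asm) nn_integral_0_iff_AE) auto
  then have AEV: "AE x in V. cos (y0 * x) = 1"
    by eventually_elim (simp add: ennreal_eq_0_iff antisym)

  define Z where "Z = {x. cos (y0 * x) = 1}"
  have [measurable]: "Z \<in> sets borel" unfolding Z_def by measurable
  have VZ: "emeasure V (- Z) = 0"
    using AE_iff_measurable[of "- Z" V "\<lambda>x. cos (y0 * x) = 1"] AEV V.borel_UNIV V.M_is_borel
    by (auto simp: Z_def)
  have "Z \<subseteq> range (\<lambda>k::int. 2 * pi * k / y0)"
  proof
    fix x assume "x \<in> Z"
    then obtain k :: int where "y0 * x = real_of_int k * 2 * pi"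
      using cos_one_2pi_int[of "y0 * x"] by (auto simp: Z_def)
    then have "x = 2 * pi * k / y0" using y0_is_least(1) by (simp add: field_simps)
    then show "x \<in> range (\<lambda>k::int. 2 * pi * k / y0)" by blast
  qed
  then have cZ: "countable Z" by (rule countable_subset) auto

  define S where "S = {x. measure \<mu> {x} > 0}"
  have cS: "countable S" unfolding S_def by (rule \<mu>.countable_atoms)
  then have [measurable]: "S \<in> sets borel" by (rule sets.countable[rotated]) simp
  define \<mu>a \<mu>c where "\<mu>a = density \<mu> (indicator S)" and "\<mu>c = density \<mu> (indicator (- S))"
  have fba: "finite_borel_measure \<mu>a" and fbc: "finite_borel_measure \<mu>c"
    unfolding \<mu>a_def \<mu>c_def by (auto intro!: finite_borel_measure_restrict[OF \<mu>])
  interpret \<mu>a: finite_borel_measure \<mu>a by (rule fba)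
  interpret \<mu>c: finite_borel_measure \<mu>c by (rule fbc)
  note [measurable_cong] = \<mu>a.M_is_borel \<mu>c.M_is_borel
  define \<rho>a \<rho>c where "\<rho>a = autocorrelation \<mu>a" and "\<rho>c = autocorrelation \<mu>c"
  have fb\<rho>a: "finite_borel_measure \<rho>a" and fb\<rho>c: "finite_borel_measure \<rho>c"
    unfolding \<rho>a_def \<rho>c_def by (auto intro!: finite_borel_measure_autocorrelation fba fbc)
  interpret \<rho>a: finite_borel_measure \<rho>a by (rule fb\<rho>a)
  interpret \<rho>c: finite_borel_measure \<rho>c by (rule fb\<rho>c)
  note [measurable_cong] = \<rho>a.M_is_borel \<rho>c.M_is_borel
  have \<rho>a_le: "emeasure \<rho>a A \<le> emeasure \<rho> A" and \<rho>c_le: "emeasure \<rho>c A \<le> emeasure \<rho> A"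
    if "A \<in> sets borel" for A
    unfolding \<rho>a_def \<rho>c_def \<rho>_def \<mu>a_def \<mu>c_def
    by (auto intro!: autocorrelation_mono[OF \<mu> _ _ that] finite_borel_measure_restrict[OF \<mu>]
        density_indicator_le)
  \<comment> \<open>Off \<open>Z\<close> the measure \<open>V\<close> vanishes, so there
    \<open>\<rho>\<close> is no larger than \<open>\<sigma>\<close>.\<close>
  have off_Z: "emeasure \<rho> (A - Z) \<le> emeasure \<sigma> (A - Z)" if [measurable]: "A \<in> sets borel" for A
  proof -
    have "emeasure V (A - Z) \<le> emeasure V (- Z)" by (intro emeasure_mono) auto
    then show ?thesis using V[of "A - Z"] VZ by simp
  qed

  txt \<open>\<open>\<mu>c\<close> has no atoms, so \<open>\<rho>c\<close> does not charge the countable set \<open>Z\<close>, which carries \<open>V\<close>.\<close>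
  have "emeasure \<rho>c Z = 0"
  proof -
    have "emeasure \<mu>c {y. x - y \<in> Z} = 0" for x
    proof -
      have "{p} \<in> null_sets \<mu>c" for p
      proof -
        have "emeasure \<mu>c {p} = emeasure \<mu> ({p} \<inter> - S)"
          unfolding \<mu>c_def using emeasure_density_cmult_indicator[of "{p}" \<mu> "- S" 1] by auto
        also have "\<dots> = 0"
          by (cases "p \<in> S") (auto simp: S_def \<mu>.emeasure_eq_measure zero_less_measure_iff)
        finally show ?thesis by auto
      qed
      then have "(\<Union>z\<in>Z. {x - z}) \<in> null_sets \<mu>c"
        by (intro null_sets_UN' cZ)
      moreover have "(\<Union>z\<in>Z. {x - z}) = {y. x - y \<in> Z}"
        by (auto intro: bexI[of _ "x - y" for y])
      ultimately show ?thesis by auto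
    qed
    moreover have "(\<integral>\<^sup>+y. indicator Z (x - y) \<partial>\<mu>c) = emeasure \<mu>c {y. x - y \<in> Z}" for x
    proof -
      have "(\<integral>\<^sup>+y. indicator Z (x - y) \<partial>\<mu>c) = (\<integral>\<^sup>+y. indicator {y. x - y \<in> Z} y \<partial>\<mu>c)"
        by (intro nn_integral_cong) (auto simp: indicator_def)
      also have "\<dots> = emeasure \<mu>c {y. x - y \<in> Z}" by (rule nn_integral_indicator) measurable
      finally show ?thesis .
    qed
    ultimately show ?thesis unfolding \<rho>c_def by (simp add: emeasure_autocorrelation_eq[OF fbc])
  qed
  have \<rho>c\<sigma>: "\<rho>c \<le> \<sigma>"
  proof (subst le_measure)
    show "\<forall>A\<in>sets \<rho>c. emeasure \<rho>c A \<le> emeasure \<sigma> A"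
    proof
      fix A assume "A \<in> sets \<rho>c"
      then have [measurable]: "A \<in> sets borel" by (simp add: \<rho>c.M_is_borel)
      have "emeasure \<rho>c A \<le> emeasure \<rho>c ((A - Z) \<union> Z)" by (intro emeasure_mono) auto
      also have "\<dots> \<le> emeasure \<rho>c (A - Z) + emeasure \<rho>c Z" by (intro emeasure_subadditive) auto
      also have "\<dots> \<le> emeasure \<sigma> (A - Z)"
        using \<rho>c_le[of "A - Z"] off_Z[of A] \<open>emeasure \<rho>c Z = 0\<close> by simp
      also have "\<dots> \<le> emeasure \<sigma> A" by (intro emeasure_mono) auto
      finally show "emeasure \<rho>c A \<le> emeasure \<sigma> A" .
    qed
  qed (simp add: \<rho>c.M_is_borel)

  txt \<open>\<open>\<rho>a\<close> lives on a countable set, which outside \<open>Z\<close> is null for \<open>\<sigma>\<close> and hence for \<open>\<rho>\<close>.\<close>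
  have "AE x in \<rho>a. cos (y0 * x) = 1"
  proof -
    define D where "D = (\<lambda>(x, y). x - y) ` (S \<times> S)"
    have cD: "countable D" unfolding D_def using cS by auto
    then have [measurable]: "D \<in> sets borel" by (rule sets.countable[rotated]) simp
    have "emeasure \<rho>a (- D) = (\<integral>\<^sup>+x. \<integral>\<^sup>+y. indicator (- D) (x - y) \<partial>\<mu>a \<partial>\<mu>a)"
      unfolding \<rho>a_def by (rule emeasure_autocorrelation_eq[OF fba]) auto
    also have "\<dots> = 0"
    proof -
      have "AE x in \<mu>a. x \<in> S" unfolding \<mu>a_def by (subst AE_density) (auto simp: indicator_def)
      then have "AE x in \<mu>a. (\<integral>\<^sup>+y. indicator (- D) (x - y) \<partial>\<mu>a) = 0"
      proof eventually_elim
        case (elim x)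
        have "AE y in \<mu>a. y \<in> S" by fact
        then have "AE y in \<mu>a. indicator (- D) (x - y) = (0::ennreal)"
          by eventually_elim (use elim in \<open>auto simp: D_def indicator_def\<close>)
        then show ?case by (subst nn_integral_0_iff_AE) auto
      qed
      then show ?thesis by (subst nn_integral_0_iff_AE) auto
    qed
    finally have D: "emeasure \<rho>a (- D) = 0" .
    have "emeasure \<sigma> (D - Z) = 0"
      using cD by (simp add: \<sigma>_def emeasure_box_measure emeasure_lborel_countable countable_Diff)
    then have "emeasure \<rho>a (D - Z) = 0"
      using \<rho>a_le[of "D - Z"] off_Z[of D] by simp
    moreover have "emeasure \<rho>a (- Z) \<le> emeasure \<rho>a ((- D) \<union> (D - Z))" by (intro emeasure_mono) auto
    moreover have "\<dots> \<le> emeasure \<rho>a (- D) + emeasure \<rho>a (D - Z)" by (intro emeasure_subadditive) auto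
    ultimately have "emeasure \<rho>a (- Z) = 0" using D by simp
    then show ?thesis
      using AE_iff_measurable[of "- Z" \<rho>a "\<lambda>x. cos (y0 * x) = 1"] \<rho>a.borel_UNIV \<rho>a.M_is_borel
      by (auto simp: Z_def)
  qed
  define a where "a = measure \<mu>a UNIV"
  have a: "cmod (char \<mu>a y0) = a"
  proof -
    \<comment> \<open>The cosine equals 1 almost everywhere for \<open>\<rho>a\<close>, so the
      characteristic function attains the largest modulus that the mass allows.\<close>
    have "(cmod (char \<mu>a y0))\<^sup>2 = (\<integral>x. cos (y0 * x) \<partial>\<rho>a)"
      unfolding \<rho>a_def by (simp add: integral_cos_autocorrelation[OF fba])
    also have "\<dots> = (\<integral>x. 1 \<partial>\<rho>a)"
      by (rule integral_cong_AE) (use \<open>AE x in \<rho>a. cos (y0 * x) = 1\<close> in auto)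
    also have "\<dots> = a\<^sup>2"
      using measure_autocorrelation_UNIV[OF fba] \<rho>a.borel_UNIV by (simp add: a_def \<rho>a_def)
    finally show ?thesis by (simp add: a_def)
  qed
  have "char \<mu> y0 = char \<mu>a y0 + char \<mu>c y0"
    unfolding \<mu>a_def \<mu>c_def by (rule char_density_split[OF \<mu>]) simp
  \<comment> \<open>The two parts cancel at \<open>y0\<close>, hence have the same modulus
    there.\<close>
  then have ac: "cmod (char \<mu>c y0) = a"
    using a char0 by (metis add_eq_0_iff norm_minus_cancel)
  have m: "measure \<mu>c UNIV = r - a"
  proof -
    have "measure \<mu>a UNIV = measure \<mu> S" "measure \<mu>c UNIV = measure \<mu> (- S)"
      using emeasure_density_cmult_indicator[of UNIV \<mu> S 1] emeasure_density_cmult_indicator[of UNIV \<mu> "- S" 1]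
      by (auto simp: \<mu>a_def \<mu>c_def measure_def)
    moreover have "measure \<mu> (- S) = measure \<mu> UNIV - measure \<mu> S"
      using \<mu>.finite_measure_compl[of S] \<mu>.borel_UNIV by (simp add: Compl_eq_Diff_UNIV)
    ultimately show ?thesis by (simp add: a_def r_def)
  qed

  txt \<open>A nonnegative trigonometric polynomial with nonnegative coefficients, so that
    dropping the frequencies \<open>2 y0\<close> and \<open>3 y0\<close> only decreases its integral against \<open>\<rho>c\<close>.\<close>
  define K where "K x = (1 + cos (y0 * x)) * (1 + 2 * cos (y0 * x))\<^sup>2" for x
  have K: "K = (\<lambda>x. 5 + 8 * cos (y0 * x) + 4 * cos ((2 * y0) * x) + cos ((3 * y0) * x))"
    unfolding K_def cos_product_expansion by (simp add: mult.assoc)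
  have K0: "K x \<ge> 0" for x unfolding K_def using cos_ge_minus_one[of "y0 * x"]
    by (intro mult_nonneg_nonneg zero_le_power2) linarith
  have "(\<integral>\<^sup>+x. ennreal (K x) \<partial>\<rho>c) \<le> (\<integral>\<^sup>+x. ennreal (K x) \<partial>\<sigma>)"
    by (intro nn_integral_mono_measure \<rho>c\<sigma>) (simp add: \<rho>c.M_is_borel)
  also have "\<dots> = ennreal (c * (10 - 46/3 * \<theta>0 + 8 * \<theta>0^2 - 8/3 * \<theta>0^3))"
  proof -
    define F where "F x = 5 * x + 8 * (sin (y0 * x) / y0) + 2 * (sin ((2 * y0) * x) / y0)
      + sin ((3 * y0) * x) / (3 * y0)" for x
    have "(\<integral>\<^sup>+x. ennreal (K x) \<partial>\<sigma>) = ennreal (c * (F 1 - F (-1)))"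
      unfolding \<sigma>_def
    proof (rule nn_integral_box_measure[OF _ K0 _ c0])
      show "K \<in> borel_measurable borel" unfolding K_def by measurable
      show "DERIV F x :> K x" for x
        unfolding F_def K using y0_is_least(1)
        by (auto intro!: derivative_eq_intros simp: field_simps)
    qed
    also have "F 1 - F (-1) = 10 + 16 * (sin y0 / y0) + 4 * (sin (2 * y0) / y0) + 2 * (sin (3 * y0) / (3 * y0))"
      by (simp add: F_def)
    also have "\<dots> = 10 - 46/3 * \<theta>0 + 8 * \<theta>0^2 - 8/3 * \<theta>0^3"
      unfolding sin_multiples_y0 sin_y0 cos_y0 using y0_is_least(1)
      by (simp add: field_simps power2_eq_square power3_eq_cube)
    finally show ?thesis .
  qed
  finally have up: "(\<integral>\<^sup>+x. ennreal (K x) \<partial>\<rho>c) \<le> ennreal (c * (10 - 46/3 * \<theta>0 + 8 * \<theta>0^2 - 8/3 * \<theta>0^3))" .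
  have cos_\<rho>c: "integrable \<rho>c (\<lambda>x. cos (t * x))"
    "(\<integral>x. cos (t * x) \<partial>\<rho>c) = (cmod (char \<mu>c t))\<^sup>2" for t
    unfolding \<rho>c_def by (rule integral_cos_autocorrelation[OF fbc])+
  have "integrable \<rho>c K"
    unfolding K using cos_\<rho>c by simp
  then have "(\<integral>\<^sup>+x. ennreal (K x) \<partial>\<rho>c) = ennreal (\<integral>x. K x \<partial>\<rho>c)"
    by (intro nn_integral_eq_integral) (auto simp: K0)
  \<comment> \<open>The constant term sees the squared mass of \<open>\<mu>c\<close>, the frequency
    \<open>y0\<close> contributes the square of \<open>ac\<close>, and the other two frequencies
    give squares that are dropped next.\<close>
  moreover have "(\<integral>x. K x \<partial>\<rho>c) = 5 * (r - a)\<^sup>2 + 8 * a\<^sup>2 + 4 * (cmod (char \<mu>c (2 * y0)))\<^sup>2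
      + (cmod (char \<mu>c (3 * y0)))\<^sup>2"
    unfolding K using measure_autocorrelation_UNIV[OF fbc, folded \<rho>c_def] \<rho>c.borel_UNIV
    by (simp add: cos_\<rho>c ac m)
  ultimately have "5 * (r - a)\<^sup>2 + 8 * a\<^sup>2 \<le> (\<integral>x. K x \<partial>\<rho>c)"
    and "ennreal (\<integral>x. K x \<partial>\<rho>c) \<le> ennreal (c * (10 - 46/3 * \<theta>0 + 8 * \<theta>0^2 - 8/3 * \<theta>0^3))"
    using up by simp_all
  moreover have "c * (10 - 46/3 * \<theta>0 + 8 * \<theta>0^2 - 8/3 * \<theta>0^3) < 5 * (r - a)\<^sup>2 + 8 * a\<^sup>2"
    by (rule atomic_mass_inequality[OF \<theta>0_bounds r ceq])
  \<comment> \<open>Positivity excludes the case where the comparison in \<open>ennreal\<close>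
    holds only because of truncation at 0.\<close>
  moreover have "5 * (r - a)\<^sup>2 + 8 * a\<^sup>2 > 0"
    using r by (cases "a = 0") (auto intro: add_nonneg_pos)
  ultimately show False
    unfolding ennreal_le_iff2 by linarith
qed

subsection \<open>Limits of tight extremizing sequences\<close>

lemma real_distribution_admissible:
  assumes "admissible \<mu>" "tv_norm \<mu> = 1"
  shows "real_distribution \<mu>"
proof -
  interpret finite_borel_measure \<mu> by (rule finite_borel_measure_admissible[OF assms(1)])
  have "prob_space \<mu>"
    using assms(2) borel_UNIV by (intro prob_spaceI) (simp add: emeasure_eq_measure tv_norm_def)
  then show ?thesis
    using M_is_borel by (simp add: real_distribution_def real_distribution_axioms_def)
qed

lemma real_distribution_autocorrelation:
  assumes "real_distribution \<mu>"
  shows "real_distribution (autocorrelation \<mu>)"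
proof -
  interpret real_distribution \<mu> by fact
  note fb = finite_borel_measure_M
  interpret A: finite_borel_measure "autocorrelation \<mu>"
    by (rule finite_borel_measure_autocorrelation[OF fb])
  have "prob_space (autocorrelation \<mu>)"
    using emeasure_autocorrelation_UNIV[OF fb] emeasure_space_1 A.borel_UNIV
    by (intro prob_spaceI) simp
  then show ?thesis
    using A.M_is_borel by (simp add: real_distribution_def real_distribution_axioms_def)
qed

lemma tight_of_tight_seq:
  assumes d: "\<And>n. real_distribution (\<mu> n)" and t: "tight_seq \<mu>"
  shows "tight \<mu>"
  unfolding tight_def
proof (intro conjI allI impI d)
  fix \<epsilon> :: real assume "\<epsilon> > 0"
  then obtain K where K: "compact K" "\<And>n. measure (\<mu> n) (UNIV - K) < \<epsilon>"
    using t unfolding tight_seq_def by blast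
  obtain B where B: "B > 0" "\<And>x. x \<in> K \<Longrightarrow> norm x \<le> B"
    using compact_imp_bounded[OF K(1)] by (auto simp: bounded_pos)
  \<comment> \<open>The extra 1 on the left keeps the point \<open>- B\<close> inside an interval
    that is open at that end.\<close>
  have "measure (\<mu> n) {- B - 1<..B} > 1 - \<epsilon>" for n
  proof -
    interpret real_distribution "\<mu> n" by (rule d)
    have "measure (\<mu> n) (UNIV - K) = 1 - measure (\<mu> n) K"
      using prob_compl[of K] K(1) by (simp add: compact_imp_closed)
    moreover have "measure (\<mu> n) K \<le> measure (\<mu> n) {- B - 1<..B}"
      using B(2) by (intro finite_measure_mono) (force simp: abs_le_iff)+
    ultimately show ?thesis using K(2)[of n] by linarith
  qed
  then show "\<exists>a b. a < b \<and> (\<forall>n. 1 - \<epsilon> < measure (\<mu> n) {a<..b})"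
    using B(1) by (intro exI[of _ "- B - 1"] exI[of _ B]) auto
qed

text \<open>Levy's continuity theorem is used in both directions: on characteristic functions,
  autocorrelation is the squared modulus, a continuous operation.\<close>

lemma weak_conv_autocorrelation:
  assumes d: "\<And>n. real_distribution (\<mu> n)" "real_distribution M" and w: "weak_conv_m \<mu> M"
  shows "weak_conv_m (\<lambda>n. autocorrelation (\<mu> n)) (autocorrelation M)"
proof (rule levy_continuity)
  fix t
  have "(\<lambda>n. char (\<mu> n) t) \<longlonglongrightarrow> char M t" by (rule levy_continuity1[OF d w])
  then have "(\<lambda>n. complex_of_real ((cmod (char (\<mu> n) t))\<^sup>2)) \<longlonglongrightarrow> complex_of_real ((cmod (char M t))\<^sup>2)"
    by (intro tendsto_intros)
  then show "(\<lambda>n. char (autocorrelation (\<mu> n)) t) \<longlonglongrightarrow> char (autocorrelation M) t"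
    by (simp add: char_autocorrelation real_distribution.finite_borel_measure_M d)
qed (use d real_distribution_autocorrelation in auto)

text \<open>This is the closed-set half of the portmanteau theorem, with lower bounds
  \<open>l n\<close> that may vary along the sequence.\<close>

lemma weak_conv_measure_Icc_ge:
  assumes d: "\<And>n. real_distribution (N n)" "real_distribution M" and w: "weak_conv_m N M"
    and l: "l \<longlonglongrightarrow> L" and le: "\<And>n. l n \<le> measure (N n) {b..a}"
  shows "L \<le> measure M {b..a}"
proof -
  interpret M: real_distribution M by (rule d(2))
  have step: "L \<le> measure M {b - \<delta>..a + \<delta>}" if \<delta>: "\<delta> > 0" for \<delta> :: real
  proof -
    \<comment> \<open>A continuous trapezoid lying between the indicators of \<open>{b..a}\<close>
      and of \<open>{b - \<delta>..a + \<delta>}\<close>, to which weak convergence applies.\<close>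
    define \<phi> where "\<phi> x = min 1 (max 0 (min ((x - b) / \<delta> + 1) ((a - x) / \<delta> + 1)))" for x
    have "isCont \<phi> x" for x unfolding \<phi>_def using \<delta> by (intro continuous_intros) auto
    moreover have "norm (\<phi> x) \<le> 1" for x by (auto simp: \<phi>_def)
    ultimately have lim: "(\<lambda>n. integral\<^sup>L (N n) \<phi>) \<longlonglongrightarrow> integral\<^sup>L M \<phi>"
      by (rule weak_conv_imp_integral_bdd_continuous_conv[OF d w])
    have [measurable]: "\<phi> \<in> borel_measurable borel" unfolding \<phi>_def by measurable
    have int: "integrable D \<phi>" if "real_distribution D" for D
    proof -
      interpret D: real_distribution D by fact
      show ?thesis by (rule D.integrable_const_bound[of _ 1]) (auto simp: \<phi>_def)
    qed
    have "l n \<le> integral\<^sup>L (N n) \<phi>" for n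
    proof -
      interpret D: real_distribution "N n" by (rule d)
      have "l n \<le> (\<integral>x. indicator {b..a} x \<partial>N n)" using le[of n] by simp
      also have "\<dots> \<le> integral\<^sup>L (N n) \<phi>"
      proof (rule integral_mono)
        show "integrable (N n) (indicator {b..a} :: real \<Rightarrow> real)"
          by (rule integrable_real_indicator) (simp_all add: D.emeasure_eq_measure)
        show "indicator {b..a} x \<le> \<phi> x" for x
          using \<delta> by (auto simp: \<phi>_def indicator_def)
      qed (rule int[OF d(1)])
      finally show ?thesis .
    qed
    then have "L \<le> integral\<^sup>L M \<phi>" using l lim by (intro LIMSEQ_le) auto
    also have "\<dots> \<le> (\<integral>x. indicator {b - \<delta>..a + \<delta>} x \<partial>M)"
    proof (rule integral_mono[OF int[OF d(2)]])
      show "integrable M (indicator {b - \<delta>..a + \<delta>} :: real \<Rightarrow> real)"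
        by (rule integrable_real_indicator) (simp_all add: M.emeasure_eq_measure)
      show "\<phi> x \<le> indicator {b - \<delta>..a + \<delta>} x" for x
      proof (cases "x \<in> {b - \<delta>..a + \<delta>}")
        case False
        then have "(x - b) / \<delta> + 1 \<le> 0 \<or> (a - x) / \<delta> + 1 \<le> 0"
          using \<delta> by (auto simp: field_simps)
        then show ?thesis using False by (auto simp: \<phi>_def)
      qed (simp add: \<phi>_def)
    qed
    also have "\<dots> = measure M {b - \<delta>..a + \<delta>}" by simp
    finally show ?thesis .
  qed
  \<comment> \<open>The enlargement is removed by continuity from above along
    \<open>\<delta> = 1 / Suc n\<close>.\<close>
  have "(\<lambda>n. measure M {b - 1 / Suc n..a + 1 / Suc n}) \<longlonglongrightarrow> measure M (\<Inter>n. {b - 1 / Suc n..a + 1 / Suc n})"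
    by (rule M.finite_Lim_measure_decseq)
       (auto simp: decseq_def intro: order_trans[OF _ diff_left_mono] order_trans[OF _ add_left_mono] frac_le)
  also have "(\<Inter>n. {b - 1 / Suc n..a + 1 / Suc n}) = {b..a}"
  proof (rule set_eqI)
    fix x
    have "b \<le> x" if "\<And>n. b - 1 / Suc n \<le> x"
      by (rule LIMSEQ_le_const2[OF _ exI[of _ 0]])
         (use that tendsto_diff[OF tendsto_const LIMSEQ_inverse_real_of_nat, of b] in \<open>auto simp: inverse_eq_divide\<close>)
    moreover have "x \<le> a" if "\<And>n. x \<le> a + 1 / Suc n"
      by (rule LIMSEQ_le_const[OF _ exI[of _ 0]])
         (use that tendsto_add[OF tendsto_const LIMSEQ_inverse_real_of_nat, of a] in \<open>auto simp: inverse_eq_divide\<close>)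
    moreover have "b - 1 / Suc n \<le> x" if "b \<le> x" for n
      using that by (smt (verit) divide_nonneg_nonneg of_nat_0_le_iff)
    moreover have "x \<le> a + 1 / Suc n" if "x \<le> a" for n
      using that by (smt (verit) divide_nonneg_nonneg of_nat_0_le_iff)
    ultimately show "x \<in> (\<Inter>n. {b - 1 / Suc n..a + 1 / Suc n}) \<longleftrightarrow> x \<in> {b..a}" by auto
  qed
  finally show ?thesis by (rule LIMSEQ_le_const) (auto intro!: step)
qed

lemma maximizer_of_tight:
  assumes e: "extremizing_seq \<mu>" and t: "tight_seq \<mu>"
  shows "\<exists>\<mu>0. maximizer \<mu>0"
proof -
  have Q: "(\<lambda>n. Q (\<mu> n)) \<longlonglongrightarrow> C4" using e by (simp add: extremizing_seq_def)
  have adm: "admissible (\<mu> n)" "tv_norm (\<mu> n) = 1" for n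
    using e by (auto simp: extremizing_seq_def)
  have d: "real_distribution (\<mu> n)" for n by (rule real_distribution_admissible[OF adm])
  \<comment> \<open>Helly's theorem for the trivial subsequence \<open>id\<close>. Tightness
    prevents mass from escaping, so the limit \<open>M\<close> is again a probability measure and
    thus admissible.\<close>
  obtain s M where s: "strict_mono (s :: nat \<Rightarrow> nat)" and M: "real_distribution M"
    and w: "weak_conv_m (\<mu> \<circ> id \<circ> s) M"
    using tight_imp_convergent_subsubsequence[OF tight_of_tight_seq[OF d t] strict_mono_id] by blast
  interpret M: real_distribution M by (rule M)
  have admM: "admissible M"
    using M.emeasure_space_1 M.finite_measure_axioms by (simp add: admissible_def)
  have tvM: "tv_norm M = 1" using M.prob_space by (simp add: tv_norm_def)
  have "C4 \<le> Q M"
    unfolding Q_def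
  proof (rule cINF_greatest)
    show "{(a, b). 1 > a \<and> a > b \<and> b > (0::real)} \<noteq> {}"
      by (rule ex_in_conv[THEN iffD1], rule exI[of _ "(1/2, 1/4)"]) simp
  next
    fix p :: "real \<times> real" assume "p \<in> {(a, b). 1 > a \<and> a > b \<and> b > 0}"
    then obtain a b where p: "p = (a, b)" and ab: "a < 1" "b < a" "0 < b" by auto
    have "C4 * (a - b) \<le> measure (autocorrelation M) {b..a}"
    proof (rule weak_conv_measure_Icc_ge)
      show "weak_conv_m (\<lambda>n. autocorrelation (\<mu> (s n))) (autocorrelation M)"
        using w by (intro weak_conv_autocorrelation d M) (simp add: comp_def)
      show "(\<lambda>n. Q (\<mu> (s n)) * (a - b)) \<longlonglongrightarrow> C4 * (a - b)"
        using LIMSEQ_subseq_LIMSEQ[OF Q s] by (intro tendsto_mult_right) (simp add: comp_def)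
      show "Q (\<mu> (s n)) * (a - b) \<le> measure (autocorrelation (\<mu> (s n))) {b..a}" for n
        using Q_le_measure[OF ab(3,2,1), of "\<mu> (s n)"] adm(2) by simp
    qed (intro real_distribution_autocorrelation d M)+
    then show "C4 \<le> (case p of (a, b) \<Rightarrow> measure (autocorrelation M) {b..a} / ((a - b) * (tv_norm M)\<^sup>2))"
      using ab by (simp add: p tvM field_simps)
  qed
  moreover have "Q \<nu> \<le> C4" if "admissible \<nu>" for \<nu>
    unfolding C4_def by (rule cSUP_upper[OF _ bdd_above_Q]) (use that in simp)
  ultimately show ?thesis using admM unfolding maximizer_def by (meson order_trans)
qed

theorem corollary1p9:
  shows "((\<not> (\<exists>\<mu>0. maximizer \<mu>0)) \<or> C4 < 1 / (2 * (1 + \<theta>0)))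
       \<and> ((\<not> (\<exists>\<mu>0. maximizer \<mu>0)) \<longrightarrow>
            \<not> (\<exists>\<mu>. extremizing_seq \<mu> \<and> tight_seq \<mu>))"
proof (intro conjI)
  \<comment> \<open>A strict bound on each \<open>Q \<mu>\<close> gives only a weak one on the
    supremum; strictness survives because a maximizer attains it.\<close>
  have "C4 < 1 / (2 * (1 + \<theta>0))" if "maximizer \<mu>0" for \<mu>0
  proof -
    have "C4 \<le> Q \<mu>0"
      unfolding C4_def using that by (intro cSUP_least) (auto simp: maximizer_def)
    also have "\<dots> < 1 / (2 * (1 + \<theta>0))"
      using that by (intro Q_less) (simp add: maximizer_def)
    finally show ?thesis .
  qed
  then show "(\<not> (\<exists>\<mu>0. maximizer \<mu>0)) \<or> C4 < 1 / (2 * (1 + \<theta>0))" by blast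
qed (use maximizer_of_tight in blast)

end
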